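(* Let $k$ be a field, let $R=k[x,y]$ or $R=k[[x,y]]$, and let $I=\langle x^{a_i}y^{b_i}\rangle_{i=0}^r\subset R$ be an $\langle x,y\rangle$-primary monomial ideal, with $a_i,b_i\in\mathbb Z_{\ge 0}$, such that $a_0=b_r=0$ and $\frac{a_i}{a_r}+\frac{b_i}{b_0}=1$ for all $i$. Let $S=\langle a_i\rangle_{i=0}^r$ and $T=\langle b_i\rangle_{i=0}^r$ be the corresponding numerical semigroups. Then the Ratliff-Rush ideal associated to $I$ is $$\tilde I=\left\langle x^sy^u : s\in S,\ s\le a_r,\ \text{and } u \text{ such that } \tfrac{s}{a_r}+\tfrac{u}{b_0}=1\right\rangle\cap\left\langle x^vy^t : t\in T,\ t\le b_0,\ \text{and } v \text{ such that } \tfrac{v}{a_r}+\tfrac{t}{b_0}=1\right\rangle .$$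
   Context: For nonnegative integers $c_0,\dots,c_r$, the numerical semigroup $\langle c_0,\dots,c_r\rangle$ is the set of all sums $\sum_i\lambda_ic_i$ with $\lambda_i\in\mathbb Z_{\ge 0}$ (the gcd of the generators need not be $1$). For a regular ideal $I$ (one containing a nonzerodivisor) in a Noetherian ring $R$, the ideals $(I^{l+1}:I^l)$, $l\ge 1$, increase with $l$, and the Ratliff-Rush ideal associated to $I$ is $\tilde I=\bigcup_{l\ge 1}(I^{l+1}:I^l)$. The exponents $u$ and $v$ range over nonnegative integers. *)

theory Defs
  imports Complex_Main
    "HOL-Computational_Algebra.Polynomial"
    "HOL-Computational_Algebra.Formal_Power_Series"
begin

text \<open>An ideal of a commutative ring is a submodule of the ring regarded as a module over itself.\<close>

lemma module_self: "module ((*) :: 'a::comm_ring_1 \<Rightarrow> 'a \<Rightarrow> 'a)"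
  by unfold_locales (simp_all add: algebra_simps)

abbreviation is_ideal :: "'a::comm_ring_1 set \<Rightarrow> bool" where
  "is_ideal \<equiv> module.subspace (*)"

abbreviation ideal_gen :: "'a::comm_ring_1 set \<Rightarrow> 'a set" where
  "ideal_gen \<equiv> module.span (*)"

definition ideal_mult :: "'a::comm_ring_1 set \<Rightarrow> 'a set \<Rightarrow> 'a set" where
  "ideal_mult I J = ideal_gen {f * g |f g. f \<in> I \<and> g \<in> J}"

primrec ideal_power :: "'a::comm_ring_1 set \<Rightarrow> nat \<Rightarrow> 'a set" where
  "ideal_power I 0 = UNIV"
| "ideal_power I (Suc n) = ideal_mult I (ideal_power I n)"

definition ideal_colon :: "'a::comm_ring_1 set \<Rightarrow> 'a set \<Rightarrow> 'a set" where
  "ideal_colon I J = {f. \<forall>g\<in>J. f * g \<in> I}"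

definition ratliff_rush :: "'a::comm_ring_1 set \<Rightarrow> 'a set" where
  "ratliff_rush I = (\<Union>l\<in>{1..}. ideal_colon (ideal_power I (l + 1)) (ideal_power I l))"

definition ideal_radical :: "'a::comm_ring_1 set \<Rightarrow> 'a set" where
  "ideal_radical I = {f. \<exists>n\<ge>1. f ^ n \<in> I}"

definition primary_ideal :: "'a::comm_ring_1 set \<Rightarrow> bool" where
  "primary_ideal Q \<longleftrightarrow> is_ideal Q \<and> Q \<noteq> UNIV \<and>
     (\<forall>f g. f * g \<in> Q \<longrightarrow> f \<in> Q \<or> (\<exists>n\<ge>1. g ^ n \<in> Q))"

text \<open>\<open>is_primary_to P Q\<close> says that \<open>Q\<close> is a \<open>P\<close>-primary ideal.\<close>

definition is_primary_to :: "'a::comm_ring_1 set \<Rightarrow> 'a set \<Rightarrow> bool" where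
  "is_primary_to P Q \<longleftrightarrow> primary_ideal Q \<and> ideal_radical Q = P"

text \<open>The ideal generated by the monomials \<open>X\<^sup>m Y\<^sup>n\<close> with exponent vector \<open>(m, n)\<close> in \<open>E\<close>,
  where \<open>X\<close> and \<open>Y\<close> are the two variables of the ring.\<close>

definition monomial_ideal :: "'a::comm_ring_1 \<Rightarrow> 'a \<Rightarrow> (nat \<times> nat) set \<Rightarrow> 'a set" where
  "monomial_ideal X Y E = ideal_gen {X ^ m * Y ^ n |m n. (m, n) \<in> E}"

definition numerical_semigroup :: "(nat \<Rightarrow> nat) \<Rightarrow> nat \<Rightarrow> nat set" where
  "numerical_semigroup c r = {n. \<exists>m :: nat \<Rightarrow> nat. n = (\<Sum>i\<le>r. m i * c i)}"

text \<open>The rings \<open>k[x,y] = k[x][y]\<close> and \<open>k[[x,y]] = k[[x]][[y]]\<close> are the types \<open>'k poly poly\<close> and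
  \<open>'k fps fps\<close>; \<open>x\<close> is the variable of the inner ring and \<open>y\<close> that of the outer one.\<close>

definition poly_x :: "'k::field poly poly" where "poly_x = [:[:0, 1:]:]"
definition poly_y :: "'k::field poly poly" where "poly_y = [:0, 1:]"

definition fps_x :: "'k::field fps fps" where "fps_x = fps_const fps_X"
definition fps_y :: "'k::field fps fps" where "fps_y = fps_X"

end

theory Submission
  imports Defs
begin

text \<open>
  Write \<open>A = a\<^sub>r\<close> and \<open>B = b\<^sub>0\<close>. Membership in a monomial ideal is read off the support, and the
  exponents of the generators of \<open>I\<^sup>l\<close> lie on the line \<open>m / A + n / B = l\<close>, so either coordinate of
  such an exponent determines the other. Multiplying by \<open>y\<^bsup>l B\<^esup>\<close> and \<open>x\<^bsup>l A\<^esup>\<close>, which lie in \<open>I\<^sup>l\<close>,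
  shows that the Ratliff-Rush ideal is contained in the two ideals on the right-hand side.
  Conversely, since \<open>A (a\<^sub>i, b\<^sub>i) = a\<^sub>i (A, 0) + (A - a\<^sub>i) (0, B)\<close>, the pigeonhole principle shows that
  for large \<open>l\<close> every generator of \<open>I\<^sup>l\<close> is divisible, with quotient a generator of \<open>I\<^bsup>l - K\<^esup>\<close>, by the
  \<open>K\<close>-th power of \<open>x\<^sup>A\<close> or of \<open>y\<^sup>B\<close>. In the second case, an element \<open>s \<le> A\<close> of \<open>S\<close> is a sum of few
  \<open>a\<^sub>i\<close>, and surplus factors \<open>y\<^sup>B\<close> (that is, summands \<open>a\<^sub>0 = 0\<close>) adjust the number of summands, so
  multiplication by \<open>x\<^sup>s y\<^sup>u\<close> leads into \<open>I\<^bsup>l + 1\<^esup>\<close>; the first case is symmetric.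
\<close>

section \<open>Ideals and generators\<close>

lemmas ideal_span_base = module.span_base[OF module_self]
  and ideal_span_zero = module.span_zero[OF module_self]
  and ideal_span_add = module.span_add[OF module_self]
  and ideal_span_mult = module.span_scale[OF module_self]
  and ideal_span_mono = module.span_mono[OF module_self]
  and ideal_span_minimal = module.span_minimal[OF module_self]
  and ideal_subspace_span = module.subspace_span[OF module_self]
  and ideal_subspaceI = module.subspaceI[OF module_self]

lemma is_ideal_colon:
  fixes J :: "'a::comm_ring_1 set"
  assumes "is_ideal J"
  shows "is_ideal {f. f * g \<in> J}"
proof (rule ideal_subspaceI)
  show "0 \<in> {f. f * g \<in> J}"
    using module.subspace_0[OF module_self assms] by simp
  show "p + q \<in> {f. f * g \<in> J}" if "p \<in> {f. f * g \<in> J}" "q \<in> {f. f * g \<in> J}" for p q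
    using module.subspace_add[OF module_self assms] that by (simp add: distrib_right)
  show "h * p \<in> {f. f * g \<in> J}" if "p \<in> {f. f * g \<in> J}" for h p
    using module.subspace_scale[OF module_self assms] that by (simp add: mult.assoc)
qed

text \<open>The multipliers that carry \<open>f\<close> into \<open>J\<close> form an ideal by
  \<open>is_ideal_colon\<close>, so it contains \<open>ideal_gen G\<close> as soon as it contains
  \<open>G\<close>.\<close>

lemma ideal_gen_mult_subset:
  fixes f :: "'a::comm_ring_1"
  assumes "is_ideal J" and "\<And>g. g \<in> G \<Longrightarrow> f * g \<in> J" and "g \<in> ideal_gen G"
  shows "f * g \<in> J"
proof -
  have "ideal_gen G \<subseteq> {g. g * f \<in> J}"
    by (rule ideal_span_minimal) (use assms in \<open>auto simp: mult.commute is_ideal_colon\<close>)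
  then show ?thesis
    using assms(3) by (auto simp: mult.commute)
qed

lemma ideal_colon_ideal_gen:
  fixes J :: "'a::comm_ring_1 set"
  assumes "is_ideal J"
  shows "ideal_colon J (ideal_gen G) = {f. \<forall>g\<in>G. f * g \<in> J}"
  unfolding ideal_colon_def
  using ideal_gen_mult_subset[OF assms] ideal_span_base by blast

lemma ideal_mult_ideal_gen:
  fixes G H :: "'a::comm_ring_1 set"
  shows "ideal_mult (ideal_gen G) (ideal_gen H) = ideal_gen {g * h |g h. g \<in> G \<and> h \<in> H}"
    (is "_ = ideal_gen ?GH")
proof
  have gh: "g * h \<in> ideal_gen ?GH" if "g \<in> G" "h \<in> H" for g h
    using that by (intro ideal_span_base) blast
  \<comment> \<open>Bilinear extension in two rounds: the second factor is freed while the first is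
    a generator, then the first.\<close>
  have gen: "g * q \<in> ideal_gen ?GH" if "g \<in> G" "q \<in> ideal_gen H" for g q
    using ideal_gen_mult_subset[OF ideal_subspace_span gh that(2)] that(1) by blast
  have "p * q \<in> ideal_gen ?GH" if "p \<in> ideal_gen G" "q \<in> ideal_gen H" for p q
    using ideal_gen_mult_subset[OF ideal_subspace_span, of G q ?GH p] gen that
    by (simp add: mult.commute)
  then show "ideal_mult (ideal_gen G) (ideal_gen H) \<subseteq> ideal_gen ?GH"
    unfolding ideal_mult_def by (intro ideal_span_minimal ideal_subspace_span) blast
  show "ideal_gen ?GH \<subseteq> ideal_mult (ideal_gen G) (ideal_gen H)"
    unfolding ideal_mult_def by (rule ideal_span_mono) (use ideal_span_base in blast)
qed

lemma ideal_mult_monomial_ideal: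
  "ideal_mult (monomial_ideal X Y E) (monomial_ideal X Y F) =
     monomial_ideal X Y {(m + m', n + n') |m n m' n'. (m, n) \<in> E \<and> (m', n') \<in> F}"
proof -
  have "{g * h |g h. g \<in> {X ^ m * Y ^ n |m n. (m, n) \<in> E} \<and> h \<in> {X ^ m * Y ^ n |m n. (m, n) \<in> F}} =
      {X ^ m * Y ^ n |m n. (m, n) \<in> {(m + m', n + n') |m n m' n'. (m, n) \<in> E \<and> (m', n') \<in> F}}"
    (is "?L = ?R")
  proof
    show "?L \<subseteq> ?R"
    proof
      fix z assume "z \<in> ?L"
      then obtain m n m' n' where "(m, n) \<in> E" "(m', n') \<in> F"
        and z: "z = (X ^ m * Y ^ n) * (X ^ m' * Y ^ n')" by blast
      moreover have "z = X ^ (m + m') * Y ^ (n + n')"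
        by (simp add: z power_add mult.commute mult.left_commute)
      ultimately show "z \<in> ?R" by blast
    qed
    show "?R \<subseteq> ?L"
    proof
      fix z assume "z \<in> ?R"
      then obtain m n m' n' where "(m, n) \<in> E" "(m', n') \<in> F"
        and z: "z = X ^ (m + m') * Y ^ (n + n')" by blast
      moreover have "z = (X ^ m * Y ^ n) * (X ^ m' * Y ^ n')"
        by (simp add: z power_add mult.commute mult.left_commute)
      ultimately show "z \<in> ?L" by blast
    qed
  qed
  then show ?thesis
    unfolding monomial_ideal_def ideal_mult_ideal_gen by simp
qed

lemma monomial_ideal_zero: "monomial_ideal X Y {(0, 0)} = UNIV"
proof -
  have "1 \<in> monomial_ideal X Y {(0, 0)}"
    unfolding monomial_ideal_def by (rule ideal_span_base) auto
  then have "f * 1 \<in> monomial_ideal X Y {(0, 0)}" for f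
    unfolding monomial_ideal_def by (rule ideal_span_mult)
  then show ?thesis by auto
qed

section \<open>Membership in monomial ideals\<close>

text \<open>In terms of monomials: the exponents of all multiples of the generators. Unions of these
  cones describe membership.\<close>

definition upset :: "(nat \<times> nat) set \<Rightarrow> (nat \<times> nat) set" where
  "upset E = {(i, j). \<exists>m n. (m, n) \<in> E \<and> m \<le> i \<and> n \<le> j}"

text \<open>A common interface to \<open>k[x,y]\<close> and \<open>k[[x,y]]\<close>, with
  \<open>cf f i j\<close> the coefficient of \<open>X ^ i * Y ^ j\<close>. The axiom
  \<open>cf_shift\<close> combines truncation and division: the mask \<open>Q\<close> selects terms,
  and the shift by \<open>(m, n)\<close> divides them by \<open>X ^ m * Y ^ n\<close>.\<close>

locale bivariate_coeffs =
  fixes X Y :: "'a::comm_ring_1" and cf :: "'a \<Rightarrow> nat \<Rightarrow> nat \<Rightarrow> 'k::ab_group_add"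
  assumes cf_eqI: "(\<And>i j. cf f i j = cf g i j) \<Longrightarrow> f = g"
    and cf_0: "cf 0 i j = 0"
    and cf_add: "cf (f + g) i j = cf f i j + cf g i j"
    and cf_monom_mult: "cf (X ^ m * Y ^ n * f) i j = (if m \<le> i \<and> n \<le> j then cf f (i - m) (j - n) else 0)"
    and cf_shift: "\<exists>g. \<forall>i j. cf g i j = (if Q i j then cf f (i + m) (j + n) else 0)"
begin

definition supp :: "'a \<Rightarrow> (nat \<times> nat) set" where
  "supp f = {(i, j). cf f i j \<noteq> 0}"

lemma supp_add: "supp (f + g) \<subseteq> supp f \<union> supp g"
  by (auto simp: supp_def cf_add)

lemma supp_mult_monom: "supp (f * (X ^ m * Y ^ n)) = (\<lambda>(i, j). (i + m, j + n)) ` supp f"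
proof -
  have "supp (X ^ m * Y ^ n * f) = (\<lambda>(i, j). (i + m, j + n)) ` supp f"
    unfolding supp_def
  proof (intro equalityI subsetI)
    fix z assume "z \<in> {(i, j). cf (X ^ m * Y ^ n * f) i j \<noteq> 0}"
    then obtain i j where "z = (i, j)" "m \<le> i" "n \<le> j" "cf f (i - m) (j - n) \<noteq> 0"
      by (auto simp: cf_monom_mult split: if_splits)
    then show "z \<in> (\<lambda>(i, j). (i + m, j + n)) ` {(i, j). cf f i j \<noteq> 0}"
      by (intro image_eqI[of _ _ "(i - m, j - n)"]) auto
  qed (auto simp: cf_monom_mult)
  then show ?thesis by (simp add: mult.commute)
qed

lemma supp_subset_upset:
  assumes "f \<in> monomial_ideal X Y E"
  shows "supp f \<subseteq> upset E"
proof -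
  let ?G = "{X ^ m * Y ^ n |m n. (m, n) \<in> E}"
  have "supp f \<subseteq> upset E"
    if "f \<in> ideal_gen ?G" for f
    using that
  proof (induction rule: module.span_induct_alt[OF module_self, consumes 1])
    case 1
    show ?case by (auto simp: supp_def cf_0)
  next
    case (2 h g f)
    then obtain m n where "g = X ^ m * Y ^ n" and mn: "(m, n) \<in> E" by blast
    then have "supp (h * g) = (\<lambda>(i, j). (i + m, j + n)) ` supp h"
      by (simp only: supp_mult_monom)
    also have "\<dots> \<subseteq> upset E"
      using mn by (auto simp: upset_def intro: le_add2)
    finally show ?case
      using 2 supp_add by blast
  qed
  with assms show ?thesis by (simp add: monomial_ideal_def)
qed

text \<open>A power series may have infinite support, so \<open>f\<close> cannot be written term by
  term as a finite combination. Instead the finitely many generators are removed one at a time, each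
  absorbing all terms that the others do not divide.\<close>

lemma mem_monomial_idealI:
  assumes "finite E" and "supp f \<subseteq> upset E"
  shows "f \<in> monomial_ideal X Y E"
  using assms
proof (induction E arbitrary: f rule: finite_induct)
  case empty
  then have "f = 0"
    by (intro cf_eqI) (auto simp: supp_def upset_def cf_0)
  then show ?case by (simp add: monomial_ideal_def ideal_span_zero)
next
  case (insert e E)
  obtain m n where e: "e = (m, n)" by fastforce
  \<comment> \<open>\<open>g\<close> is the part of \<open>f\<close> outside \<open>upset E\<close>,
    divided by the new generator; \<open>h\<close> below is the part inside, left to the induction
    hypothesis.\<close>
  obtain g where g: "\<And>i j. cf g i j = (if (i + m, j + n) \<notin> upset E then cf f (i + m) (j + n) else 0)"
    using cf_shift[of "\<lambda>i j. (i + m, j + n) \<notin> upset E" f m n] by blast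
  have "\<exists>h. \<forall>i j. cf h i j = (if (i, j) \<in> upset E then cf f i j else 0)"
    using cf_shift[of "\<lambda>i j. (i, j) \<in> upset E" f 0 0] by (simp only: add_0_right)
  then obtain h where h: "\<And>i j. cf h i j = (if (i, j) \<in> upset E then cf f i j else 0)"
    by blast
  have "cf f i j = 0" if "(i, j) \<notin> upset E" "\<not> (m \<le> i \<and> n \<le> j)" for i j
    using insert.prems that by (auto simp: supp_def upset_def e)
  then have f: "f = g * (X ^ m * Y ^ n) + h"
    by (intro cf_eqI) (auto simp: cf_add cf_monom_mult g h mult.commute[of g])
  have "h \<in> monomial_ideal X Y E"
    by (intro insert.IH) (auto simp: supp_def h split: if_splits)
  moreover have "monomial_ideal X Y E \<subseteq> monomial_ideal X Y (insert e E)"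
    unfolding monomial_ideal_def by (rule ideal_span_mono) auto
  moreover have "g * (X ^ m * Y ^ n) \<in> monomial_ideal X Y (insert e E)"
    unfolding monomial_ideal_def e by (intro ideal_span_mult ideal_span_base) auto
  ultimately show ?case
    unfolding f using ideal_span_add[of "g * (X ^ m * Y ^ n)" _ h]
    by (auto simp only: monomial_ideal_def)
qed

lemma mem_monomial_ideal_iff:
  assumes "finite E"
  shows "f \<in> monomial_ideal X Y E \<longleftrightarrow> supp f \<subseteq> upset E"
  using assms mem_monomial_idealI supp_subset_upset by blast

end

section \<open>Polynomials and power series as instances\<close>

lemma bivariate_coeffs_poly:
  "bivariate_coeffs poly_x poly_y (\<lambda>(f :: 'k::field poly poly) i j. coeff (coeff f j) i)"
proof
  fix f g :: "'k poly poly" and i j m n :: nat and Q :: "nat \<Rightarrow> nat \<Rightarrow> bool"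
  show "f = g" if "\<And>i j. coeff (coeff f j) i = coeff (coeff g j) i"
    using that by (intro poly_eqI)
  have x: "poly_x ^ m = [:monom 1 m:]"
    by (simp add: poly_x_def poly_const_pow monom_altdef)
  have y: "poly_y ^ n = monom 1 n"
    by (simp add: poly_y_def monom_altdef)
  show "coeff (coeff (poly_x ^ m * poly_y ^ n * f) j) i =
      (if m \<le> i \<and> n \<le> j then coeff (coeff f (j - n)) (i - m) else 0)"
    by (simp add: x y mult.assoc coeff_monom_mult)
  \<comment> \<open>\<open>F j\<close> is to be the coefficient of \<open>y ^ j\<close>. Both uses
    of \<open>Abs_poly\<close> require eventual vanishing, which the degrees in \<open>f\<close>
    supply.\<close>
  define F where "F j = Abs_poly (\<lambda>i. if Q i j then coeff (coeff f (j + n)) (i + m) else 0)" for j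
  have F: "coeff (F j) i = (if Q i j then coeff (coeff f (j + n)) (i + m) else 0)" for i j
    unfolding F_def
    by (subst coeff_Abs_poly[where n = "degree (coeff f (j + n))"]) (auto intro: coeff_eq_0)
  have "F j = 0" if "j > degree f" for j
    using that by (intro poly_eqI) (simp add: F coeff_eq_0)
  then have "coeff (Abs_poly F) j = F j" for j
    by (subst coeff_Abs_poly) auto
  then show "\<exists>g. \<forall>i j. coeff (coeff g j) i = (if Q i j then coeff (coeff f (j + n)) (i + m) else 0)"
    using F by metis
qed simp_all

lemma bivariate_coeffs_fps:
  "bivariate_coeffs fps_x fps_y (\<lambda>(f :: 'k::field fps fps) i j. fps_nth (fps_nth f j) i)"
proof
  fix f g :: "'k fps fps" and i j m n :: nat and Q :: "nat \<Rightarrow> nat \<Rightarrow> bool"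
  show "f = g" if "\<And>i j. fps_nth (fps_nth f j) i = fps_nth (fps_nth g j) i"
    using that by (intro fps_ext)
  show "fps_nth (fps_nth (fps_x ^ m * fps_y ^ n * f) j) i =
      (if m \<le> i \<and> n \<le> j then fps_nth (fps_nth f (j - n)) (i - m) else 0)"
    by (simp add: fps_x_def fps_y_def fps_const_power mult.assoc fps_X_power_mult_nth)
  show "\<exists>g. \<forall>i j. fps_nth (fps_nth g j) i = (if Q i j then fps_nth (fps_nth f (j + n)) (i + m) else 0)"
    by (rule exI[of _ "Abs_fps (\<lambda>j. Abs_fps (\<lambda>i. if Q i j then fps_nth (fps_nth f (j + n)) (i + m) else 0))"])
      simp
qed simp_all

section \<open>Sums of generators on a line\<close>

text \<open>The indices \<open>p\<close> and \<open>q\<close> of the two endpoints are kept abstract, so that exchanging the two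
  coordinates is again an instance of the locale.\<close>

locale collinear_exponents =
  fixes J :: "'i set" and p q :: 'i and a b :: "'i \<Rightarrow> nat" and A B :: nat
  assumes finite_J: "finite J" and p_in: "p \<in> J" and q_in: "q \<in> J"
    and a_p: "a p = 0" and b_p: "b p = B" and a_q: "a q = A" and b_q: "b q = 0"
    and A_pos: "0 < A" and B_pos: "0 < B"
    and line: "\<And>i. i \<in> J \<Longrightarrow> a i * B + b i * A = A * B"
begin

lemma swapped: "collinear_exponents J q p b a B A"
  using finite_J p_in q_in a_p b_p a_q b_q A_pos B_pos line
  by unfold_locales (auto simp: add.commute mult.commute)

text \<open>With \<open>c i\<close> the multiplicity of generator \<open>i\<close>, these are the
  exponents of the \<open>l\<close>-fold products of generators, hence of generators of the
  \<open>l\<close>-th power (\<open>ideal_power_eq\<close>).\<close>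

definition fold_sums :: "nat \<Rightarrow> (nat \<times> nat) set" where
  "fold_sums l = {(\<Sum>i\<in>J. c i * a i, \<Sum>i\<in>J. c i * b i) |c. (\<Sum>i\<in>J. c i) = l}"

lemma swapped_fold_sums: "collinear_exponents.fold_sums J b a l = prod.swap ` fold_sums l"
  by (force simp: collinear_exponents.fold_sums_def[OF swapped] fold_sums_def image_iff)

lemma fold_sumsI:
  "(\<Sum>i\<in>J. c i) = l \<Longrightarrow> (\<Sum>i\<in>J. c i * a i) = m \<Longrightarrow> (\<Sum>i\<in>J. c i * b i) = n \<Longrightarrow> (m, n) \<in> fold_sums l"
  unfolding fold_sums_def by blast

lemma fold_sumsE:
  assumes "(m, n) \<in> fold_sums l"
  obtains c where "(\<Sum>i\<in>J. c i) = l" "(\<Sum>i\<in>J. c i * a i) = m" "(\<Sum>i\<in>J. c i * b i) = n"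
  using assms unfolding fold_sums_def by blast

lemma fold_sums_add:
  assumes "(m, n) \<in> fold_sums l" "(m', n') \<in> fold_sums l'"
  shows "(m + m', n + n') \<in> fold_sums (l + l')"
proof -
  obtain c where c: "(\<Sum>i\<in>J. c i) = l" "(\<Sum>i\<in>J. c i * a i) = m" "(\<Sum>i\<in>J. c i * b i) = n"
    using assms(1) by (rule fold_sumsE)
  obtain d where d: "(\<Sum>i\<in>J. d i) = l'" "(\<Sum>i\<in>J. d i * a i) = m'" "(\<Sum>i\<in>J. d i * b i) = n'"
    using assms(2) by (rule fold_sumsE)
  show ?thesis
    by (rule fold_sumsI[of "\<lambda>i. c i + d i"]) (simp_all add: c d distrib_right sum.distrib)
qed

lemma fold_sums_multiple:
  assumes "i \<in> J"
  shows "(k * a i, k * b i) \<in> fold_sums k"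
proof -
  have "(\<Sum>j\<in>J. (if j = i then k else 0) * f j) = k * f i" for f :: "'i \<Rightarrow> nat"
    using assms finite_J by (simp add: if_distrib[of "\<lambda>z. z * _"] cong: if_cong)
  moreover have "(\<Sum>j\<in>J. if j = i then k else 0) = k"
    using assms finite_J by simp
  ultimately show ?thesis
    by (intro fold_sumsI[of "\<lambda>j. if j = i then k else 0"])
qed

text \<open>The line equation of each generator is summed with multiplicity. Thus \<open>l\<close>
  and one coordinate determine the other coordinate.\<close>

lemma fold_sums_line:
  assumes "(m, n) \<in> fold_sums l"
  shows "m * B + n * A = l * A * B"
proof -
  obtain c where c: "(\<Sum>i\<in>J. c i) = l" "(\<Sum>i\<in>J. c i * a i) = m" "(\<Sum>i\<in>J. c i * b i) = n"
    using assms by (rule fold_sumsE)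
  have "m * B + n * A = (\<Sum>i\<in>J. c i * (a i * B + b i * A))"
    by (simp add: c[symmetric] sum_distrib_right sum.distrib distrib_left mult.assoc)
  also have "\<dots> = (\<Sum>i\<in>J. c i * (A * B))"
    by (intro sum.cong) (simp_all add: line)
  also have "\<dots> = l * A * B"
    by (simp add: c[symmetric] sum_distrib_right mult.assoc)
  finally show ?thesis .
qed

lemma finite_fold_sums: "finite (fold_sums l)"
proof (rule finite_subset)
  show "fold_sums l \<subseteq> {..l * A * B} \<times> {..l * A * B}"
  proof clarify
    fix m n assume "(m, n) \<in> fold_sums l"
    then have "m * B + n * A = l * A * B" by (rule fold_sums_line)
    moreover have "m * 1 \<le> m * B" "n * 1 \<le> n * A"
      using A_pos B_pos by (intro mult_le_mono2; simp)+
    ultimately have "m \<le> l * A * B" "n \<le> l * A * B" by linarith+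
    then show "m \<in> {..l * A * B} \<and> n \<in> {..l * A * B}" by simp
  qed
qed simp

lemma fold_sums_0: "fold_sums 0 = {(0, 0)}"
  unfolding fold_sums_def using finite_J by (auto intro!: exI[of _ "\<lambda>_. 0"])

text \<open>Lowering one multiplicity by \<open>k\<close> removes \<open>k\<close> copies of
  generator \<open>i\<close>. The bound \<open>k \<le> l\<close> is recorded because subtraction in
  \<open>l - k\<close> truncates.\<close>

lemma fold_sums_decrement:
  assumes c: "(\<Sum>j\<in>J. c j) = l" "(\<Sum>j\<in>J. c j * a j) = m" "(\<Sum>j\<in>J. c j * b j) = n"
    and i: "i \<in> J" and k: "k \<le> c i"
  shows "\<exists>m' n'. (m', n') \<in> fold_sums (l - k) \<and> m = m' + k * a i \<and> n = n' + k * b i \<and> k \<le> l"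
proof -
  define d where "d j = (if j = i then c i - k else c j)" for j
  have sum: "(\<Sum>j\<in>J. c j * f j) = (\<Sum>j\<in>J. d j * f j) + k * f i" for f :: "'i \<Rightarrow> nat"
  proof -
    have "(\<Sum>j\<in>J. c j * f j) = c i * f i + (\<Sum>j\<in>J - {i}. c j * f j)"
      using i finite_J by (rule sum.remove[rotated])
    moreover have "(\<Sum>j\<in>J. d j * f j) = d i * f i + (\<Sum>j\<in>J - {i}. d j * f j)"
      using i finite_J by (rule sum.remove[rotated])
    moreover have "(\<Sum>j\<in>J - {i}. c j * f j) = (\<Sum>j\<in>J - {i}. d j * f j)"
      by (intro sum.cong) (auto simp: d_def)
    moreover have "c i * f i = d i * f i + k * f i"
      using k by (simp add: d_def distrib_right[symmetric])
    ultimately show ?thesis by simp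
  qed
  have "l = (\<Sum>j\<in>J. d j) + k"
    using sum[of "\<lambda>_. 1"] c(1) by simp
  then show ?thesis
    using sum[of a] sum[of b] c(2,3)
    by (intro exI[of _ "\<Sum>j\<in>J. d j * a j"] exI[of _ "\<Sum>j\<in>J. d j * b j"]) (auto intro: fold_sumsI)
qed

text \<open>Splitting off one summand mirrors the recursion of \<open>ideal_power\<close>.\<close>

lemma fold_sums_Suc:
  "fold_sums (Suc l) = {(m + m', n + n') |m n m' n'. (m, n) \<in> (\<lambda>i. (a i, b i)) ` J \<and> (m', n') \<in> fold_sums l}"
proof (intro equalityI subsetI)
  fix z assume z: "z \<in> fold_sums (Suc l)"
  obtain m n where mn: "z = (m, n)" by fastforce
  obtain c where c: "(\<Sum>i\<in>J. c i) = Suc l" "(\<Sum>i\<in>J. c i * a i) = m" "(\<Sum>i\<in>J. c i * b i) = n"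
    using z unfolding mn by (rule fold_sumsE)
  have "\<exists>i\<in>J. 1 \<le> c i"
  proof (rule ccontr)
    assume "\<not> (\<exists>i\<in>J. 1 \<le> c i)"
    then have "(\<Sum>i\<in>J. c i) = 0" by (simp add: not_le)
    with c(1) show False by simp
  qed
  then obtain i where i: "i \<in> J" "1 \<le> c i" by blast
  obtain m' n' where "(m', n') \<in> fold_sums l" "z = (a i + m', b i + n')"
    using fold_sums_decrement[OF c i] by (auto simp: mn)
  then show "z \<in> {(m + m', n + n') |m n m' n'. (m, n) \<in> (\<lambda>i. (a i, b i)) ` J \<and> (m', n') \<in> fold_sums l}"
    using i(1) by blast
next
  fix z assume "z \<in> {(m + m', n + n') |m n m' n'. (m, n) \<in> (\<lambda>i. (a i, b i)) ` J \<and> (m', n') \<in> fold_sums l}"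
  then obtain i m' n' where "i \<in> J" "(m', n') \<in> fold_sums l" "z = (a i + m', b i + n')" by blast
  then show "z \<in> fold_sums (Suc l)"
    using fold_sums_add[OF fold_sums_multiple[of i 1]] by simp
qed

lemma a_le: "i \<in> J \<Longrightarrow> a i \<le> A"
  using line[of i] B_pos by (metis le_add1 mult_le_cancel2)

text \<open>Some generator occurs at least \<open>A * K\<close> times. As \<open>A\<close> copies of
  \<open>(a i, b i)\<close> have the same sum as \<open>a i\<close> copies of \<open>(A, 0)\<close>
  and \<open>A - a i\<close> copies of \<open>(0, B)\<close>, they can be traded for endpoints
  without changing the number of summands. Then some endpoint occurs \<open>K\<close> times and can
  be split off.\<close>

lemma fold_sums_endpoint_dichotomy:
  assumes l: "card J * (A * K) < l" and mn: "(m, n) \<in> fold_sums l"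
  shows "K \<le> l \<and> ((\<exists>n'. (m, n') \<in> fold_sums (l - K) \<and> n = n' + K * B) \<or>
                   (\<exists>m'. (m', n) \<in> fold_sums (l - K) \<and> m = m' + K * A))"
proof -
  obtain c where c: "(\<Sum>i\<in>J. c i) = l" "(\<Sum>i\<in>J. c i * a i) = m" "(\<Sum>i\<in>J. c i * b i) = n"
    using mn by (rule fold_sumsE)
  have "\<exists>i\<in>J. A * K \<le> c i"
  proof (rule ccontr)
    assume "\<not> (\<exists>i\<in>J. A * K \<le> c i)"
    then have "(\<Sum>i\<in>J. c i) \<le> of_nat (card J) * (A * K)"
      by (intro sum_bounded_above) auto
    with l c(1) show False by simp
  qed
  then obtain i where i: "i \<in> J" "A * K \<le> c i" by blast
  obtain m0 n0 where mn0: "(m0, n0) \<in> fold_sums (l - A * K)" "m = m0 + A * K * a i"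
    "n = n0 + A * K * b i" and AK: "A * K \<le> l"
    using fold_sums_decrement[OF c i] by blast
  \<comment> \<open>The \<open>A * K\<close> removed copies become \<open>K * a i\<close> copies of
    \<open>(A, 0)\<close> and \<open>K * x\<close> copies of \<open>(0, B)\<close>.\<close>
  define x where "x = A - a i"
  have Ax: "A = a i + x" using a_le[OF i(1)] by (simp add: x_def)
  have "b i * A = x * B"
    using line[OF i(1)] by (simp add: Ax distrib_right)
  then have n: "n = n0 + K * x * B"
    using mn0(3) by (metis mult.assoc mult.commute)
  have pt: "(s * A, t * B) \<in> fold_sums (s + t)" for s t
    using fold_sums_add[OF fold_sums_multiple[OF q_in, of s] fold_sums_multiple[OF p_in, of t]]
    by (simp add: a_p b_p a_q b_q)
  have KA: "K \<le> A * K" using A_pos by simp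
  then have Kl: "K \<le> l" using AK by (rule le_trans)
  have AKx: "A * K = K * a i + K * x" by (simp add: Ax distrib_left mult.commute)
  show ?thesis
  \<comment> \<open>If \<open>a i = 0\<close>, all \<open>A * K\<close> copies are
    \<open>(0, B)\<close>; otherwise \<open>K * a i\<close> is at least \<open>K\<close>, so
    \<open>K\<close> copies of \<open>(A, 0)\<close> are available.\<close>
  proof (cases "a i = 0")
    case True
    then have xA: "x = A" by (simp add: x_def)
    have "l - A * K + (0 + (A * K - K)) = l - K"
      using KA AK by simp
    then have "(m0 + 0 * A, n0 + (A * K - K) * B) \<in> fold_sums (l - K)"
      using fold_sums_add[OF mn0(1) pt, of 0 "A * K - K"] by (simp only:)
    then have "(m, n0 + (A * K - K) * B) \<in> fold_sums (l - K)"
      using mn0(2) True by simp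
    moreover have "(A * K - K) * B + K * B = K * x * B"
      unfolding xA distrib_right[symmetric] le_add_diff_inverse2[OF KA] by (simp only: mult.commute)
    ultimately show ?thesis
      using n Kl by (intro conjI disjI1 exI[of _ "n0 + (A * K - K) * B"]) auto
  next
    case False
    have Ka: "K \<le> K * a i" using False by simp
    have "(m0 + (K * a i - K) * A, n0 + K * x * B) \<in> fold_sums (l - A * K + ((K * a i - K) + K * x))"
      by (rule fold_sums_add[OF mn0(1) pt])
    moreover have "l - A * K + ((K * a i - K) + K * x) = l - K"
      using Ka AK AKx by linarith
    moreover have "(K * a i - K) * A + K * A = A * K * a i"
      unfolding distrib_right[symmetric] le_add_diff_inverse2[OF Ka]
      by (simp only: mult.commute mult.left_commute)
    ultimately show ?thesis
      using n mn0(2) Kl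
      by (intro conjI disjI2 exI[of _ "m0 + (K * a i - K) * A"]) auto
  qed
qed

text \<open>Summands \<open>a\<^sub>i = 0\<close> are discarded first, so that the number of summands is at most \<open>s\<close>; the rest
  is filled up with \<open>a\<^sub>p = 0\<close>.\<close>

lemma semigroup_in_fold_sums:
  assumes s: "s = (\<Sum>i\<in>J. c i * a i)" and sK: "s \<le> K" and su: "s * B + u * A = A * B"
  shows "(s, u + K * B) \<in> fold_sums (K + 1)"
proof -
  define d where "d i = (if a i = 0 then 0 else c i)" for i
  have sd: "s = (\<Sum>i\<in>J. d i * a i)"
    unfolding s d_def by (intro sum.cong) auto
  \<comment> \<open>Wherever \<open>d i\<close> is nonzero, \<open>a i\<close> is at least
    1.\<close>
  have "(\<Sum>i\<in>J. d i) \<le> (\<Sum>i\<in>J. d i * a i)"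
    by (intro sum_mono) (auto simp: d_def)
  then have k: "(\<Sum>i\<in>J. d i) \<le> K" using sd sK by simp
  define k where "k = (\<Sum>i\<in>J. d i)"
  have "(s, (\<Sum>i\<in>J. d i * b i)) \<in> fold_sums k"
    by (rule fold_sumsI[of d]) (simp_all add: k_def sd)
  from fold_sums_add[OF this fold_sums_multiple[OF p_in, of "K + 1 - k"]]
  obtain n where n: "(s, n) \<in> fold_sums (K + 1)"
    using k by (auto simp: a_p k_def)
  \<comment> \<open>The second coordinate is forced: both points lie on the line of level
    \<open>K + 1\<close> over \<open>s\<close>.\<close>
  have "n * A = (u + K * B) * A"
    using fold_sums_line[OF n] su by (simp add: distrib_left distrib_right mult.commute mult.left_commute)
  then have "n = u + K * B" using A_pos by simp
  with n show ?thesis by simp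
qed

section \<open>The first ideal on the right-hand side, with denominators cleared\<close>

definition semigroup_exponents :: "(nat \<times> nat) set" where
  "semigroup_exponents =
    {(s, u). (\<exists>c. s = (\<Sum>i\<in>J. c i * a i)) \<and> s \<le> A \<and> s * B + u * A = A * B}"

lemma finite_semigroup_exponents: "finite semigroup_exponents"
proof (rule finite_subset)
  show "semigroup_exponents \<subseteq> {..A} \<times> {..B}"
  proof clarify
    fix s u assume su: "(s, u) \<in> semigroup_exponents"
    then have "s * B + u * A = A * B"
      by (simp add: semigroup_exponents_def)
    then have "u * A \<le> B * A"
      by (metis le_add2 mult.commute)
    then have "u \<le> B" using A_pos by simp
    then show "s \<in> {..A} \<and> u \<in> {..B}"
      using su by (auto simp: semigroup_exponents_def)
  qed
qed simp

text \<open>The \<open>K\<close> surplus copies of \<open>(0, B)\<close> together with a generator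
  \<open>(s, u)\<close> below \<open>(i, j)\<close> form a sum of \<open>K + 1\<close> generators;
  \<open>A \<le> K\<close> guarantees \<open>s \<le> K\<close>. The remaining \<open>l - K\<close>
  summands are untouched.\<close>

lemma translate_in_upset_fold_sums:
  assumes ij: "(i, j) \<in> upset semigroup_exponents" and AK: "A \<le> K" and Kl: "K \<le> l"
    and mn: "(m, n) \<in> fold_sums (l - K)"
  shows "(i + m, j + (n + K * B)) \<in> upset (fold_sums (l + 1))"
proof -
  obtain s u where su: "(s, u) \<in> semigroup_exponents" "s \<le> i" "u \<le> j"
    using ij by (auto simp: upset_def)
  then obtain c where "s = (\<Sum>i\<in>J. c i * a i)" "s \<le> K" "s * B + u * A = A * B"
    using AK by (auto simp: semigroup_exponents_def)
  then have "(s, u + K * B) \<in> fold_sums (K + 1)" by (rule semigroup_in_fold_sums)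
  from fold_sums_add[OF this mn] have "(s + m, u + K * B + n) \<in> fold_sums (l + 1)"
    using Kl by (simp add: add.commute)
  then show ?thesis
    unfolding upset_def using su(2,3) by fastforce
qed

lemma upset_semigroup_exponentsI:
  assumes "\<And>m n. (m, n) \<in> fold_sums l \<Longrightarrow> (i + m, j + n) \<in> upset (fold_sums (l + 1))"
  shows "(i, j) \<in> upset semigroup_exponents"
proof -
  \<comment> \<open>Testing against the single monomial \<open>Y ^ (l * B)\<close> suffices.\<close>
  have "(0, l * B) \<in> fold_sums l"
    using fold_sums_multiple[OF p_in, of l] by (simp add: a_p b_p)
  from assms[OF this] obtain m n where mn: "(m, n) \<in> fold_sums (l + 1)" "m \<le> i" "n \<le> j + l * B"
    by (auto simp: upset_def)
  have mnl: "m * B + n * A = (l + 1) * A * B"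
    using mn(1) by (rule fold_sums_line)
  have semi: "\<exists>c. m = (\<Sum>i\<in>J. c i * a i)"
    using mn(1) by (elim fold_sumsE) blast
  show ?thesis
  proof (cases "m \<le> A")
    \<comment> \<open>Here the line of level \<open>l + 1\<close> forces \<open>n\<close> to be at
      least \<open>l * B\<close>, and removing \<open>l * B\<close> brings the point down to level
      1.\<close>
    case True
    then have "m * B \<le> A * B" by simp
    moreover have "(l + 1) * A * B = l * B * A + A * B"
      by (simp add: algebra_simps)
    ultimately have "l * B * A \<le> n * A" using mnl by linarith
    then have lB: "l * B \<le> n" using A_pos by simp
    define u where "u = n - l * B"
    have n: "n = u + l * B" using lB by (simp add: u_def)
    have "m * B + u * A = A * B"
      using mnl by (simp add: n algebra_simps)
    then have "(m, u) \<in> semigroup_exponents"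
      using True semi by (simp add: semigroup_exponents_def)
    then show ?thesis
      using mn(2,3) n by (auto simp: upset_def)
  next
    \<comment> \<open>Now \<open>i\<close> exceeds \<open>A\<close>, so the generator
      \<open>(A, 0)\<close> already lies below \<open>(i, j)\<close>.\<close>
    case False
    have "(1 * a q, 1 * b q) \<in> fold_sums 1" using q_in by (rule fold_sums_multiple)
    then have "\<exists>c. A = (\<Sum>i\<in>J. c i * a i)"
      by (elim fold_sumsE) (auto simp: a_q)
    then have "(A, 0) \<in> semigroup_exponents" by (simp add: semigroup_exponents_def)
    then show ?thesis
      unfolding upset_def using False mn(2) by force
  qed
qed

end

section \<open>The second ideal, by exchanging the coordinates\<close>

lemma swap_image_iff: "(i, j) \<in> prod.swap ` E \<longleftrightarrow> (j, i) \<in> E"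
  by force

lemma upset_swap: "(i, j) \<in> upset (prod.swap ` E) \<longleftrightarrow> (j, i) \<in> upset E"
  by (force simp: upset_def)

context collinear_exponents
begin

definition semigroup_exponents' :: "(nat \<times> nat) set" where
  "semigroup_exponents' =
    {(v, t). (\<exists>c. t = (\<Sum>i\<in>J. c i * b i)) \<and> t \<le> B \<and> v * B + t * A = A * B}"

lemma swapped_semigroup_exponents:
  "collinear_exponents.semigroup_exponents J b B A = prod.swap ` semigroup_exponents'"
  unfolding collinear_exponents.semigroup_exponents_def[OF swapped] semigroup_exponents'_def
  by (auto simp: image_iff add.commute mult.commute)

lemma finite_semigroup_exponents': "finite semigroup_exponents'"
  using collinear_exponents.finite_semigroup_exponents[OF swapped]
  unfolding swapped_semigroup_exponents by (simp add: finite_image_iff)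

lemma translate_in_upset_fold_sums':
  assumes "(i, j) \<in> upset semigroup_exponents'" "B \<le> K" "K \<le> l" "(m, n) \<in> fold_sums (l - K)"
  shows "(i + (m + K * A), j + n) \<in> upset (fold_sums (l + 1))"
  using collinear_exponents.translate_in_upset_fold_sums[OF swapped, of j i K l n m] assms
  unfolding swapped_semigroup_exponents swapped_fold_sums upset_swap swap_image_iff by blast

lemma upset_semigroup_exponentsI':
  assumes "\<And>m n. (m, n) \<in> fold_sums l \<Longrightarrow> (i + m, j + n) \<in> upset (fold_sums (l + 1))"
  shows "(i, j) \<in> upset semigroup_exponents'"
  using collinear_exponents.upset_semigroup_exponentsI[OF swapped, of l j i] assms
  unfolding swapped_semigroup_exponents swapped_fold_sums upset_swap swap_image_iff by blast

lemma ideal_power_eq: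
  "ideal_power (monomial_ideal X Y ((\<lambda>i. (a i, b i)) ` J)) l = monomial_ideal X Y (fold_sums l)"
  by (induction l) (simp_all add: fold_sums_0 monomial_ideal_zero ideal_mult_monomial_ideal fold_sums_Suc)

end

section \<open>The Ratliff-Rush ideal in terms of exponents\<close>

locale collinear_monomials = bivariate_coeffs X Y cf + collinear_exponents J p q a b A B
  for X Y :: "'a::comm_ring_1" and cf :: "'a \<Rightarrow> nat \<Rightarrow> nat \<Rightarrow> 'k::ab_group_add"
    and J :: "'i set" and p q a b A B
begin

text \<open>The colon need only be tested on monomial generators, and multiplication by a monomial
  translates the support. This reduces the theorem to statements about exponents.\<close>

lemma mem_ideal_colon_iff:
  "f \<in> ideal_colon (monomial_ideal X Y (fold_sums (l + 1))) (monomial_ideal X Y (fold_sums l)) \<longleftrightarrow>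
     (\<forall>(i, j)\<in>supp f. \<forall>(m, n)\<in>fold_sums l. (i + m, j + n) \<in> upset (fold_sums (l + 1)))"
proof -
  have "f \<in> ideal_colon (monomial_ideal X Y (fold_sums (l + 1))) (monomial_ideal X Y (fold_sums l)) \<longleftrightarrow>
      (\<forall>(m, n)\<in>fold_sums l. f * (X ^ m * Y ^ n) \<in> monomial_ideal X Y (fold_sums (l + 1)))"
    unfolding monomial_ideal_def by (subst ideal_colon_ideal_gen[OF ideal_subspace_span]) blast
  then show ?thesis
    by (auto simp: mem_monomial_ideal_iff[OF finite_fold_sums] supp_mult_monom image_subset_iff)
qed

theorem ratliff_rush_eq:
  "ratliff_rush (monomial_ideal X Y ((\<lambda>i. (a i, b i)) ` J)) =
     monomial_ideal X Y semigroup_exponents \<inter> monomial_ideal X Y semigroup_exponents'"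
proof (intro equalityI subsetI)
  fix f assume "f \<in> ratliff_rush (monomial_ideal X Y ((\<lambda>i. (a i, b i)) ` J))"
  then obtain l where
    "f \<in> ideal_colon (monomial_ideal X Y (fold_sums (l + 1))) (monomial_ideal X Y (fold_sums l))"
    unfolding ratliff_rush_def ideal_power_eq by blast
  then have "(i + m, j + n) \<in> upset (fold_sums (l + 1))" if "(i, j) \<in> supp f" "(m, n) \<in> fold_sums l" for i j m n
    using that unfolding mem_ideal_colon_iff by fast
  then have "(i, j) \<in> upset semigroup_exponents \<inter> upset semigroup_exponents'" if "(i, j) \<in> supp f" for i j
    using upset_semigroup_exponentsI upset_semigroup_exponentsI' that by blast
  then have "supp f \<subseteq> upset semigroup_exponents" "supp f \<subseteq> upset semigroup_exponents'"
    by auto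
  then show "f \<in> monomial_ideal X Y semigroup_exponents \<inter> monomial_ideal X Y semigroup_exponents'"
    by (simp add: mem_monomial_ideal_iff finite_semigroup_exponents finite_semigroup_exponents')
next
  fix f assume "f \<in> monomial_ideal X Y semigroup_exponents \<inter> monomial_ideal X Y semigroup_exponents'"
  then have f: "supp f \<subseteq> upset semigroup_exponents" "supp f \<subseteq> upset semigroup_exponents'"
    by (simp_all add: mem_monomial_ideal_iff finite_semigroup_exponents finite_semigroup_exponents')
  \<comment> \<open>\<open>K\<close> must dominate both \<open>A\<close> and \<open>B\<close>, since
    either endpoint may be the one split off; \<open>l\<close> just exceeds the pigeonhole threshold
    and works for all terms of \<open>f\<close> at once.\<close>
  define K where "K = A + B"
  define l where "l = card J * (A * K) + 1"
  have "(i + m, j + n) \<in> upset (fold_sums (l + 1))" if ij: "(i, j) \<in> supp f" and mn: "(m, n) \<in> fold_sums l"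
    for i j m n
  proof -
    have "card J * (A * K) < l" by (simp add: l_def)
    from fold_sums_endpoint_dichotomy[OF this mn] have "K \<le> l" and
      "(\<exists>n'. (m, n') \<in> fold_sums (l - K) \<and> n = n' + K * B) \<or> (\<exists>m'. (m', n) \<in> fold_sums (l - K) \<and> m = m' + K * A)"
      by blast+
    moreover have "(i, j) \<in> upset semigroup_exponents" "(i, j) \<in> upset semigroup_exponents'"
      using f ij by blast+
    moreover have "A \<le> K" "B \<le> K"
      by (simp_all add: K_def)
    ultimately show ?thesis
      using translate_in_upset_fold_sums translate_in_upset_fold_sums' by blast
  qed
  then have "f \<in> ideal_colon (monomial_ideal X Y (fold_sums (l + 1))) (monomial_ideal X Y (fold_sums l))"
    unfolding mem_ideal_colon_iff by blast
  moreover have "l \<in> {1..}" by (simp add: l_def)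
  ultimately show "f \<in> ratliff_rush (monomial_ideal X Y ((\<lambda>i. (a i, b i)) ` J))"
    unfolding ratliff_rush_def ideal_power_eq by blast
qed

end

section \<open>Return to the real line equation and the two concrete rings\<close>

lemma real_line_iff:
  fixes A B m n :: nat
  assumes "0 < A" "0 < B"
  shows "real m / real A + real n / real B = 1 \<longleftrightarrow> m * B + n * A = A * B"
proof -
  have "real m / real A + real n / real B = real (m * B + n * A) / real (A * B)"
    using assms by (simp add: add_frac_eq)
  then have "real m / real A + real n / real B = 1 \<longleftrightarrow> real (m * B + n * A) = real (A * B)"
    using assms by (simp only: divide_eq_1_iff of_nat_eq_0_iff mult_eq_0_iff) simp
  then show ?thesis by (simp only: of_nat_eq_iff)
qed

theorem proposition3p14:
  fixes r :: nat and a b :: "nat \<Rightarrow> nat"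
    and x y :: "'k::field poly poly" and x' y' :: "'k fps fps"
  assumes "a 0 = 0" and "b r = 0"
    and "\<forall>i\<le>r. real (a i) / real (a r) + real (b i) / real (b 0) = 1"
    and S: "S = numerical_semigroup a r"
    and T: "T = numerical_semigroup b r"
    and polynomial_vars: "x = poly_x" "y = poly_y"
    and power_series_vars: "x' = fps_x" "y' = fps_y"
  shows
    "(\<forall>I. I = monomial_ideal x y {(a i, b i) |i. i \<le> r} \<and> is_primary_to (ideal_gen {x, y}) I \<longrightarrow>
        ratliff_rush I =
          monomial_ideal x y
            {(s, u). s \<in> S \<and> s \<le> a r \<and> real s / real (a r) + real u / real (b 0) = 1} \<inter>
          monomial_ideal x y
            {(v, t). t \<in> T \<and> t \<le> b 0 \<and> real v / real (a r) + real t / real (b 0) = 1}) \<and>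
     (\<forall>I. I = monomial_ideal x' y' {(a i, b i) |i. i \<le> r} \<and> is_primary_to (ideal_gen {x', y'}) I \<longrightarrow>
        ratliff_rush I =
          monomial_ideal x' y'
            {(s, u). s \<in> S \<and> s \<le> a r \<and> real s / real (a r) + real u / real (b 0) = 1} \<inter>
          monomial_ideal x' y'
            {(v, t). t \<in> T \<and> t \<le> b 0 \<and> real v / real (a r) + real t / real (b 0) = 1})"
proof -
  \<comment> \<open>Division by zero yields 0, so \<open>a r = 0\<close> would turn the line
    equation at \<open>i = r\<close> into \<open>0 = 1\<close>; likewise for \<open>b 0\<close> at
    \<open>i = 0\<close>.\<close>
  have A: "0 < a r"
    using assms(3)[rule_format, of r] assms(2) by (cases "a r = 0") simp_all
  have B: "0 < b 0"
    using assms(3)[rule_format, of 0] assms(1) by (cases "b 0 = 0") simp_all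
  have line: "a i * b 0 + b i * a r = a r * b 0" if "i \<le> r" for i
    using assms(3)[rule_format, OF that] by (simp only: real_line_iff[OF A B])
  have E: "collinear_exponents {..r} 0 r a b (a r) (b 0)"
    by unfold_locales (simp_all add: assms(1,2) A B line)
  have gens: "{(a i, b i) |i. i \<le> r} = (\<lambda>i. (a i, b i)) ` {..r}"
    by auto
  have expS: "{(s, u). s \<in> S \<and> s \<le> a r \<and> real s / real (a r) + real u / real (b 0) = 1} =
      collinear_exponents.semigroup_exponents {..r} a (a r) (b 0)"
    unfolding collinear_exponents.semigroup_exponents_def[OF E] real_line_iff[OF A B]
    by (simp add: S numerical_semigroup_def)
  have expT: "{(v, t). t \<in> T \<and> t \<le> b 0 \<and> real v / real (a r) + real t / real (b 0) = 1} =
      collinear_exponents.semigroup_exponents' {..r} b (a r) (b 0)"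
    unfolding collinear_exponents.semigroup_exponents'_def[OF E] real_line_iff[OF A B]
    by (simp add: T numerical_semigroup_def)
  have poly: "collinear_monomials x y (\<lambda>f i j. coeff (coeff f j) i) {..r} 0 r a b (a r) (b 0)"
    unfolding polynomial_vars by (rule collinear_monomials.intro[OF bivariate_coeffs_poly E])
  have fps:
    "collinear_monomials x' y' (\<lambda>f i j. fps_nth (fps_nth f j) i) {..r} 0 r a b (a r) (b 0)"
    unfolding power_series_vars by (rule collinear_monomials.intro[OF bivariate_coeffs_fps E])
  show ?thesis
    unfolding gens expS expT
    using collinear_monomials.ratliff_rush_eq[OF poly] collinear_monomials.ratliff_rush_eq[OF fps]
    by blast
qed

end
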